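(* Let $m \geq n \geq 1$ be integers, and let $k_1, k_2$ be integers with $1 \leq k_1 \leq \lfloor \frac{m}{n} \rfloor$ and $\lfloor \frac{m}{2} \rfloor \leq k_2 < m$. Put $m^* = m - n k_1$ and $k_2^* = k_2 - k_1$. Let $N$ be the number of ways to distribute $m$ identical balls into $n$ distinct boxes so that each box contains at least $k_1$ and at most $k_2$ balls. (A) If $m^* \leq k_2^* < m - k_1$, then $$N = \binom{m - n k_1 + n - 1}{n-1}.$$ (B) If $\lfloor \frac{m}{2} \rfloor - k_1 \leq k_2^* < m^*$, then $$N = \binom{m - n k_1 + n - 1}{n-1} - n \binom{m - n k_1 - (k_2 - k_1) + n - 2}{n-1}.$$
   Context: A distribution of $m$ identical balls into $n$ distinct boxes is an $n$-tuple $(X_1,\dots,X_n)$ of nonnegative integers with $X_1+\cdots+X_n=m$ (all balls are distributed with no remainder), where $X_i$ is the number of balls in box $i$. The number of ways is the number of such tuples satisfying the stated constraints. *)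

theory Defs
  imports Main
begin

text \<open>An \<open>n\<close>-tuple is a list of length \<open>n\<close>; position \<open>i\<close> holds the number of balls in box \<open>i\<close>.\<close>

definition distributions :: "nat \<Rightarrow> nat \<Rightarrow> nat list set" where
  "distributions m n = {X. length X = n \<and> sum_list X = m}"

definition num_bounded_distributions :: "nat \<Rightarrow> nat \<Rightarrow> nat \<Rightarrow> nat \<Rightarrow> nat" where
  "num_bounded_distributions m n k\<^sub>1 k\<^sub>2 =
     card {X \<in> distributions m n. \<forall>i<n. k\<^sub>1 \<le> X ! i \<and> X ! i \<le> k\<^sub>2}"

end

(* Inclusion-exclusion over the boxes that exceed the upper bound stops after one term: since
   2 (k2 + 1) > m, no two boxes can exceed k2 at once. Counting the distributions
   with prescribed lower bounds reduces to the unrestricted count by subtracting the bounds. *)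
theory Submission imports Defs begin

text \<open>The lower bounds form a list, one per box, so that the bound of a single box can be
  raised by a list update. Every term of the inclusion-exclusion is then an instance of this one
  set.\<close>

definition distributions_above :: "nat list \<Rightarrow> nat \<Rightarrow> nat list set" where
  "distributions_above a m = {X. list_all2 (\<le>) a X \<and> sum_list X = m}"

lemma sum_list_le_if_list_all2_le:
  fixes a X :: "nat list"
  assumes "list_all2 (\<le>) a X"
  shows "sum_list a \<le> sum_list X"
  using assms by (induction rule: list_all2_induct) auto

lemma distributions_above_empty:
  assumes "m < sum_list a"
  shows "distributions_above a m = {}"
  using assms by (auto simp: distributions_above_def dest: sum_list_le_if_list_all2_le)

text \<open>Stars and bars: the library count chooses the \<open>m\<close> stars, and symmetry of
  the binomial turns this into choosing the \<open>n - 1\<close> bars. With no boxes and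
  \<open>m > 0\<close> the formula would wrongly give 1.\<close>

lemma card_distributions:
  assumes "1 \<le> n"
  shows "card (distributions m n) = (m + n - 1) choose (n - 1)"
proof -
  have "(m + n - 1) choose m = (m + n - 1) choose (n - 1)"
    using assms binomial_symmetric[of m "m + n - 1"] by simp
  then show ?thesis
    unfolding distributions_def by (simp add: card_length_sum_list)
qed

lemma finite_distributions: "finite (distributions m n)"
proof -
  have "distributions m n \<subseteq> {X. set X \<subseteq> {..m} \<and> length X = n}"
    unfolding distributions_def using member_le_sum_list by fastforce
  then show ?thesis
    using finite_lists_length_eq[of "{..m}" n] finite_subset by blast
qed

lemma distributions_above_subset: "distributions_above a m \<subseteq> distributions m (length a)"
  unfolding distributions_above_def distributions_def by (auto dest: list_all2_lengthD)

lemma finite_distributions_above: "finite (distributions_above a m)"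
  using distributions_above_subset finite_distributions finite_subset by blast

lemma sum_list_map2_add:
  fixes a Y :: "nat list"
  assumes "length a = length Y"
  shows "sum_list (map2 (+) a Y) = sum_list a + sum_list Y"
  using assms by (induction rule: list_induct2) auto

text \<open>Entrywise addition of \<open>a\<close> is a bijection from the unrestricted
  distributions of the remaining balls. If \<open>sum_list a\<close> exceeded \<open>m\<close>,
  truncated subtraction would make the right side 1 although the set is empty.\<close>

lemma card_distributions_above:
  assumes "sum_list a \<le> m" and "a \<noteq> []"
  shows "card (distributions_above a m) = (m - sum_list a + length a - 1) choose (length a - 1)"
proof -
  have "bij_betw (map2 (+) a) (distributions (m - sum_list a) (length a)) (distributions_above a m)"
  proof (rule bij_betw_byWitness[where f' = "\<lambda>X. map2 (-) X a"])
    show "\<forall>Y\<in>distributions (m - sum_list a) (length a). map2 (-) (map2 (+) a Y) a = Y"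
      by (auto simp: distributions_def intro!: nth_equalityI)
    \<comment> \<open>Truncated subtraction loses nothing here because \<open>a\<close> lies
      entrywise below \<open>X\<close>. The fact is reused below to compute the sum of a difference
      through addition.\<close>
    show inv: "\<forall>X\<in>distributions_above a m. map2 (+) a (map2 (-) X a) = X"
      by (auto simp: distributions_above_def list_all2_conv_all_nth intro!: nth_equalityI)
    show "map2 (+) a ` distributions (m - sum_list a) (length a) \<subseteq> distributions_above a m"
      using assms(1)
      by (auto simp: distributions_def distributions_above_def list_all2_conv_all_nth
          sum_list_map2_add)
    show "(\<lambda>X. map2 (-) X a) ` distributions_above a m
            \<subseteq> distributions (m - sum_list a) (length a)"
    proof
      fix Y assume "Y \<in> (\<lambda>X. map2 (-) X a) ` distributions_above a m"
      then obtain X where X: "X \<in> distributions_above a m" "Y = map2 (-) X a" by blast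
      have len: "length Y = length a"
        using X list_all2_lengthD unfolding distributions_above_def by fastforce
      have "map2 (+) a Y = X" using inv X by blast
      then have "sum_list a + sum_list Y = m"
        using X(1) sum_list_map2_add[of a Y] len unfolding distributions_above_def by auto
      then show "Y \<in> distributions (m - sum_list a) (length a)"
        using len unfolding distributions_def by auto
    qed
  qed
  then show ?thesis
    using assms(2) bij_betw_same_card card_distributions[of "length a" "m - sum_list a"]
    by (metis One_nat_def Suc_leI length_greater_0_conv)
qed

lemma mem_distributions_above_replicate:
  "X \<in> distributions_above (replicate n k) m \<longleftrightarrow> X \<in> distributions m n \<and> (\<forall>i<n. k \<le> X ! i)"
  unfolding distributions_above_def distributions_def by (auto simp: list_all2_conv_all_nth)

text \<open>Since \<open>k \<le> l\<close>, the raised bound at box \<open>i\<close> still implies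
  the old one. With \<open>l\<close> one more than the upper bound, this describes the distributions
  that overfill box \<open>i\<close>.\<close>

lemma mem_distributions_above_replicate_update:
  assumes "i < n" and "k \<le> l"
  shows "X \<in> distributions_above ((replicate n k)[i := l]) m \<longleftrightarrow>
    X \<in> distributions_above (replicate n k) m \<and> l \<le> X ! i"
proof -
  have "k \<le> X ! j" if "\<forall>j<n. (if i = j then l else k) \<le> X ! j" and "j < n" for j
    using that assms(2) by (cases "i = j") auto
  then have "(\<forall>j<n. (if i = j then l else k) \<le> X ! j) \<longleftrightarrow> (\<forall>j<n. k \<le> X ! j) \<and> l \<le> X ! i"
    using assms(1) by (metis (full_types))
  moreover have "(replicate n k)[i := l] ! j = (if i = j then l else k)" if "j < n" for j
    using that by (simp add: nth_list_update)
  moreover have "replicate n k ! j = k" if "j < n" for j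
    using that by simp
  ultimately have "(\<forall>j<n. (replicate n k)[i := l] ! j \<le> X ! j)
      \<longleftrightarrow> (\<forall>j<n. replicate n k ! j \<le> X ! j) \<and> l \<le> X ! i"
    by (simp only: cong: imp_cong)
  then show ?thesis
    unfolding distributions_above_def list_all2_conv_all_nth
      length_list_update length_replicate mem_Collect_eq by argo
qed

text \<open>The identity is additive to avoid subtraction on naturals. The second hypothesis holds
  as soon as there are two boxes.\<close>

lemma num_bounded_distributions_plus_overfull:
  assumes "k\<^sub>1 \<le> k\<^sub>2" and "2 * k\<^sub>1 \<le> n * k\<^sub>1" and "m < 2 * (k\<^sub>2 + 1)"
  shows "num_bounded_distributions m n k\<^sub>1 k\<^sub>2
      + (\<Sum>i<n. card (distributions_above ((replicate n k\<^sub>1)[i := k\<^sub>2 + 1]) m))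
    = card (distributions_above (replicate n k\<^sub>1) m)"
proof -
  define S where "S = distributions_above (replicate n k\<^sub>1) m"
  define B where "B i = distributions_above ((replicate n k\<^sub>1)[i := k\<^sub>2 + 1]) m" for i
  define G where "G = {X \<in> distributions m n. \<forall>i<n. k\<^sub>1 \<le> X ! i \<and> X ! i \<le> k\<^sub>2}"
  have B: "X \<in> B i \<longleftrightarrow> X \<in> S \<and> k\<^sub>2 + 1 \<le> X ! i" if "i < n" for i X
    using that assms(1) mem_distributions_above_replicate_update unfolding B_def S_def by simp
  have disj: "B i \<inter> B j = {}" if ij: "i < n" "j < n" "i \<noteq> j" for i j
  proof -
    \<comment> \<open>A distribution overfilling both boxes would satisfy these bounds, whose sum is
      at least \<open>2 * (k\<^sub>2 + 1)\<close> and so exceeds \<open>m\<close>.\<close>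
    define a where "a = (replicate n k\<^sub>1)[i := k\<^sub>2 + 1, j := k\<^sub>2 + 1]"
    have "B i \<inter> B j \<subseteq> distributions_above a m"
      using ij unfolding a_def B_def distributions_above_def
      by (auto simp: list_all2_conv_all_nth nth_list_update split: if_splits)
    moreover have "sum_list a = n * k\<^sub>1 + 2 * (k\<^sub>2 + 1) - 2 * k\<^sub>1"
      using ij assms(1,2) unfolding a_def by (simp add: sum_list_update sum_list_replicate)
    moreover have "m < sum_list a"
      using calculation(2) assms(2,3) by linarith
    ultimately show ?thesis
      using distributions_above_empty[of m a] by simp
  qed
  have "S = G \<union> (\<Union>i<n. B i)"
    using B unfolding G_def S_def
    by (auto simp: mem_distributions_above_replicate)
  moreover have "G \<inter> (\<Union>i<n. B i) = {}"
    using B unfolding G_def by fastforce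
  moreover have "finite G" unfolding G_def using finite_distributions by simp
  moreover have "finite (B i)" for i unfolding B_def by (rule finite_distributions_above)
  ultimately have "card S = card G + card (\<Union>i<n. B i)"
    by (simp add: card_Un_disjoint)
  also have "card (\<Union>i<n. B i) = (\<Sum>i<n. card (B i))"
    using disj finite_distributions_above unfolding B_def by (intro card_UN_disjoint) auto
  finally show ?thesis
    unfolding S_def B_def G_def num_bounded_distributions_def by simp
qed

lemma num_bounded_distributions_one_box:
  assumes "k\<^sub>2 < m"
  shows "num_bounded_distributions m 1 k\<^sub>1 k\<^sub>2 = 0"
proof -
  have "{X \<in> distributions m 1. \<forall>i<1. k\<^sub>1 \<le> X ! i \<and> X ! i \<le> k\<^sub>2} = {}"
    using assms unfolding distributions_def by (auto simp: length_Suc_conv)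
  then show ?thesis unfolding num_bounded_distributions_def by (metis card.empty)
qed

theorem mainTheorem4:
  fixes m n k\<^sub>1 k\<^sub>2 N :: nat and m_star k2_star :: int
  assumes "1 \<le> n" and "n \<le> m"
    and "1 \<le> k\<^sub>1" and "k\<^sub>1 \<le> m div n"
    and "m div 2 \<le> k\<^sub>2" and "k\<^sub>2 < m"
    and "m_star = int m - int n * int k\<^sub>1"
    and "k2_star = int k\<^sub>2 - int k\<^sub>1"
    and "N = num_bounded_distributions m n k\<^sub>1 k\<^sub>2"
  shows "(m_star \<le> k2_star \<and> k2_star < int m - int k\<^sub>1 \<longrightarrow>
           int N = int (nat (int m - int n * int k\<^sub>1 + int n - 1) choose (n - 1)))
       \<and> (int (m div 2) - int k\<^sub>1 \<le> k2_star \<and> k2_star < m_star \<longrightarrow>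
           int N = int (nat (int m - int n * int k\<^sub>1 + int n - 1) choose (n - 1))
             - int n * int (nat (int m - int n * int k\<^sub>1 - (int k\<^sub>2 - int k\<^sub>1) + int n - 2) choose (n - 1)))"
proof (cases "n = 1")
  \<comment> \<open>The only candidate puts all \<open>m > k\<^sub>2\<close> balls into one box, so
    the count is 0. Case (A) is vacuous, as \<open>k2_star < m_star\<close>, and both binomials in
    (B) have lower index 0, giving 1 - 1.\<close>
  case True
  then show ?thesis
    using assms num_bounded_distributions_one_box by simp
next
  case False
  then have n: "2 \<le> n" using assms(1) by simp
  have nk: "n * k\<^sub>1 \<le> m"
    using assms(4) by (meson mult_le_mono2 order_trans times_div_less_eq_dividend)
  then have nk_int: "int n * int k\<^sub>1 \<le> int m"
    by (metis of_nat_le_iff of_nat_mult)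
  have two: "2 * k\<^sub>1 \<le> n * k\<^sub>1" using n by simp
  \<comment> \<open>Two boxes already need \<open>2 * k\<^sub>1 \<le> m\<close>, hence
    \<open>k\<^sub>1 \<le> m div 2\<close>.\<close>
  have k12: "k\<^sub>1 \<le> k\<^sub>2" using nk two assms(5) by linarith
  \<comment> \<open>\<open>b\<close> is the sum of the lower bounds once a single box is raised to
    \<open>k\<^sub>2 + 1\<close>. Cases (A) and (B) are exactly \<open>m < b\<close> and
    \<open>b \<le> m\<close>: either no box can be overfull, or each contributes the same
    binomial.\<close>
  define b where "b = n * k\<^sub>1 + (k\<^sub>2 + 1 - k\<^sub>1)"
  have count: "N + (\<Sum>i<n. card (distributions_above ((replicate n k\<^sub>1)[i := k\<^sub>2 + 1]) m))
      = (m - n * k\<^sub>1 + n - 1) choose (n - 1)"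
    using num_bounded_distributions_plus_overfull[OF k12 two, of m] assms(5,9) n nk
      card_distributions_above[of "replicate n k\<^sub>1" m]
    by (simp add: sum_list_replicate)
  have sum_b: "sum_list ((replicate n k\<^sub>1)[i := k\<^sub>2 + 1]) = b" if "i < n" for i
    using that k12 unfolding b_def by (simp add: sum_list_update sum_list_replicate)
  have total: "nat (int m - int n * int k\<^sub>1 + int n - 1) = m - n * k\<^sub>1 + n - 1"
    using nk nk_int n by (simp add: nat_eq_iff of_nat_diff)
  show ?thesis
  proof (intro conjI impI)
    assume "m_star \<le> k2_star \<and> k2_star < int m - int k\<^sub>1"
    then have "int m < int b"
      using assms(7,8) k12 unfolding b_def by (simp add: of_nat_diff)
    then have "distributions_above ((replicate n k\<^sub>1)[i := k\<^sub>2 + 1]) m = {}" if "i < n" for i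
      using distributions_above_empty sum_b that by simp
    then show "int N = int (nat (int m - int n * int k\<^sub>1 + int n - 1) choose (n - 1))"
      using count total by simp
  next
    assume "int (m div 2) - int k\<^sub>1 \<le> k2_star \<and> k2_star < m_star"
    then have "int b \<le> int m"
      using assms(7,8) k12 unfolding b_def by (simp add: of_nat_diff)
    then have bm: "b \<le> m" by simp
    have "card (distributions_above ((replicate n k\<^sub>1)[i := k\<^sub>2 + 1]) m)
        = (m - b + n - 1) choose (n - 1)" if "i < n" for i
      using card_distributions_above[of "(replicate n k\<^sub>1)[i := k\<^sub>2 + 1]" m] sum_b that bm n by simp
    then have "N + n * ((m - b + n - 1) choose (n - 1)) = (m - n * k\<^sub>1 + n - 1) choose (n - 1)"
      using count by simp
    \<comment> \<open>Passing to integers before subtracting keeps the difference in (B)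
      exact.\<close>
    then have "int N + int n * int ((m - b + n - 1) choose (n - 1))
        = int ((m - n * k\<^sub>1 + n - 1) choose (n - 1))"
      by (metis of_nat_add of_nat_mult)
    moreover have "int b = int n * int k\<^sub>1 + (int k\<^sub>2 + 1 - int k\<^sub>1)"
      using k12 unfolding b_def by (simp add: of_nat_diff)
    \<comment> \<open>The extra 1 in \<open>b\<close>, from the strict excess over
      \<open>k\<^sub>2\<close>, turns \<open>n - 1\<close> into the \<open>n - 2\<close> of the
      formula.\<close>
    then have "nat (int m - int n * int k\<^sub>1 - (int k\<^sub>2 - int k\<^sub>1) + int n - 2) = m - b + n - 1"
      using bm n by (simp add: nat_eq_iff of_nat_diff)
    ultimately show "int N = int (nat (int m - int n * int k\<^sub>1 + int n - 1) choose (n - 1))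
        - int n * int (nat (int m - int n * int k\<^sub>1 - (int k\<^sub>2 - int k\<^sub>1) + int n - 2) choose (n - 1))"
      using total by simp
  qed
qed

end
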